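(* For every even $r\ge 4$, $2^r\le \zeta_e(BF(r))\le \left(\frac{r}{2}+2\right)2^{r-1}$.
   Context: The $r$-dimensional butterfly network $BF(r)$ has vertex set $\{[w;i] : w\in\{0,1\}^r,\ 0\le i\le r\}$, and $[w;i]$ is adjacent to $[w';j]$ iff $j=i+1$ and either $w=w'$ or $w$ and $w'$ differ precisely in the $j$-th bit. Forcing (closure) rule: for a graph $G=(V,E)$ and $T\subseteq V$, the closure $C_G(T)$ starts as $T$ and, as long as some vertex of $C_G(T)$ has exactly one neighbor not in $C_G(T)$, that neighbor is added. Edge-forcing set: a set $K$ of pairwise independent edges of $G$ such that, with $T$ the set of endpoints of edges of $K$, $C_G(T)=V$. $\zeta_e(G)$ is the minimum cardinality of an edge-forcing set of $G$. *)

theory Defs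
  imports Complex_Main "HOL-Library.Disjoint_Sets"
begin

text \<open>
  A finite simple graph is given by a vertex set \<open>V\<close> and a set \<open>E\<close> of two-element subsets of \<open>V\<close>.
\<close>

definition nbrs :: "'a set set \<Rightarrow> 'a \<Rightarrow> 'a set" where
  "nbrs E u = {v. {u, v} \<in> E}"

definition force_step :: "'a set set \<Rightarrow> 'a set \<Rightarrow> 'a set \<Rightarrow> bool" where
  "force_step E S S' \<longleftrightarrow> (\<exists>u\<in>S. \<exists>v. nbrs E u - S = {v} \<and> S' = insert v S)"

text \<open>
  The closure is the set at which the forcing process started from \<open>T\<close> stops. On a finite graph
  it exists and does not depend on the choices made (lemma \<open>forcing_closure_unique\<close> below).
\<close>

definition forcing_closure :: "'a set set \<Rightarrow> 'a set \<Rightarrow> 'a set" where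
  "forcing_closure E T = (THE S. (force_step E)\<^sup>*\<^sup>* T S \<and> (\<nexists>S'. force_step E S S'))"

definition edge_forcing_set :: "'a set \<Rightarrow> 'a set set \<Rightarrow> 'a set set \<Rightarrow> bool" where
  "edge_forcing_set V E K \<longleftrightarrow> K \<subseteq> E \<and> disjoint K \<and> forcing_closure E (\<Union>K) = V"

text \<open>
  If there were no edge-forcing set at all, the infimum would be \<open>0\<close>.
\<close>

definition edge_forcing_number :: "'a set \<Rightarrow> 'a set set \<Rightarrow> nat" where
  "edge_forcing_number V E = Inf {card K |K. finite K \<and> edge_forcing_set V E K}"

text \<open>
  The bits of \<open>w\<close> are numbered \<open>1, \<dots>, r\<close>, so bit \<open>k\<close> is the list entry \<open>w ! (k - 1)\<close>.
\<close>

definition bf_verts :: "nat \<Rightarrow> (bool list \<times> nat) set" where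
  "bf_verts r = {(w, i). length w = r \<and> i \<le> r}"

definition bf_edges :: "nat \<Rightarrow> (bool list \<times> nat) set set" where
  "bf_edges r = {{(w, i), (w', j)} |w i w' j.
     (w, i) \<in> bf_verts r \<and> (w', j) \<in> bf_verts r \<and> j = i + 1 \<and>
     (w = w' \<or> {k \<in> {1..r}. w ! (k - 1) \<noteq> w' ! (k - 1)} = {j})}"

lemma finite_bf_verts: "finite (bf_verts r)"
proof -
  have "bf_verts r = {w. set w \<subseteq> UNIV \<and> length w = r} \<times> {..r}"
    by (auto simp: bf_verts_def)
  then show ?thesis
    using finite_lists_length_eq[of "UNIV :: bool set" r] by simp
qed

lemma bf_edges_subset: "e \<in> bf_edges r \<Longrightarrow> e \<subseteq> bf_verts r"
  by (auto simp: bf_edges_def)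

lemma force_step_subset_stalled:
  assumes "force_step E S S'" "S \<subseteq> R" "\<nexists>R'. force_step E R R'"
  shows "S' \<subseteq> R"
proof (rule ccontr)
  assume "\<not> S' \<subseteq> R"
  moreover obtain u v where uv: "u \<in> S" "nbrs E u - S = {v}" "S' = insert v S"
    using assms(1) by (auto simp: force_step_def)
  ultimately have "nbrs E u - R = {v}"
    using assms(2) by blast
  then have "force_step E R (insert v R)"
    using uv(1) assms(2) by (auto simp: force_step_def)
  then show False
    using assms(3) by blast
qed

lemma force_steps_subset_stalled:
  assumes "(force_step E)\<^sup>*\<^sup>* S S'" "S \<subseteq> R" "\<nexists>R'. force_step E R R'"
  shows "S' \<subseteq> R"
  using assms(1,2)
proof (induction rule: rtranclp_induct)
  case (step y z)
  then show ?case
    using force_step_subset_stalled assms(3) by metis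
qed

lemma force_steps_increasing: "(force_step E)\<^sup>*\<^sup>* S S' \<Longrightarrow> S \<subseteq> S'"
  by (induction rule: rtranclp_induct) (auto simp: force_step_def)

lemma forcing_closure_unique:
  assumes "finite V" "\<And>e. e \<in> E \<Longrightarrow> e \<subseteq> V" "T \<subseteq> V"
  shows "\<exists>!S. (force_step E)\<^sup>*\<^sup>* T S \<and> (\<nexists>S'. force_step E S S')"
proof (rule ex_ex1I)
  show "\<exists>S. (force_step E)\<^sup>*\<^sup>* T S \<and> (\<nexists>S'. force_step E S S')"
    using assms(3)
  proof (induction "card (V - T)" arbitrary: T rule: less_induct)
    case less
    show ?case
    proof (cases "\<exists>S'. force_step E T S'")
      case True
      then obtain u v where uv: "u \<in> T" "nbrs E u - T = {v}"
        by (auto simp: force_step_def)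
      then have "v \<in> V" "v \<notin> T"
        using assms(2)[of "{u, v}"] by (auto simp: nbrs_def)
      then have "card (V - insert v T) < card (V - T)"
        using assms(1) by (intro psubset_card_mono) auto
      moreover have "force_step E T (insert v T)"
        using uv by (auto simp: force_step_def)
      ultimately show ?thesis
        using less(1)[of "insert v T"] less(2) \<open>v \<in> V\<close>
        by (meson converse_rtranclp_into_rtranclp insert_subset)
    qed blast
  qed
next
  fix S R
  assume S: "(force_step E)\<^sup>*\<^sup>* T S \<and> (\<nexists>S'. force_step E S S')"
    and R: "(force_step E)\<^sup>*\<^sup>* T R \<and> (\<nexists>R'. force_step E R R')"
  have "S \<subseteq> R"
    using force_steps_subset_stalled[of E T S R] force_steps_increasing[of E T R] S R by simp
  moreover have "R \<subseteq> S"
    using force_steps_subset_stalled[of E T R S] force_steps_increasing[of E T S] S R by simp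
  ultimately show "S = R" ..
qed

end

theory Submission
  imports Defs
begin

text \<open>
  Lower bound: in level \<open>0\<close> the vertices \<open>[w;0]\<close> and \<open>[w';0]\<close>, where \<open>w'\<close> is \<open>w\<close> with bit \<open>1\<close>
  flipped, have the same neighbours, so the forcing process can never add the first of them, and
  one must be present initially. The same holds in level \<open>r\<close> for bit \<open>r\<close>. Hence an edge-forcing
  set covers at least \<open>2 ^ r\<close> vertices of the two outer levels, and every edge meets these levels
  in at most one vertex.

  Upper bound: if levels \<open>i - 1\<close> and \<open>i\<close> are filled and the initial set meets every pair of level
  \<open>i + 1\<close> that differs in bit \<open>i + 1\<close>, then level \<open>i + 1\<close> gets filled. All edges \<open>[w;0][w;1]\<close>
  fill levels \<open>0\<close> and \<open>1\<close>. The edges \<open>[w;i][w;i+1]\<close> with \<open>w\<^sub>i = w\<^sub>i\<^sub>+\<^sub>1\<close> meet all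
  pairs of levels \<open>i\<close> and \<open>i + 1\<close>, which serves levels \<open>5, \<dots>, r\<close>. The odd number of levels left,
  \<open>2, 3, 4\<close>, is served by \<open>[w;2][w;3]\<close> for \<open>w\<^sub>2 \<noteq> w\<^sub>4\<close> and \<open>[w;3][w;4]\<close> for \<open>w\<^sub>2 = w\<^sub>4\<close>.
\<close>

section \<open>Forcing closure\<close>

lemma forcing_closure_props:
  assumes "finite V" "\<And>e. e \<in> E \<Longrightarrow> e \<subseteq> V" "T \<subseteq> V"
  shows "(force_step E)\<^sup>*\<^sup>* T (forcing_closure E T)"
    and "\<nexists>S'. force_step E (forcing_closure E T) S'"
  using theI'[OF forcing_closure_unique[OF assms]] unfolding forcing_closure_def by blast+

lemma forcing_closure_subset:
  assumes "finite V" "\<And>e. e \<in> E \<Longrightarrow> e \<subseteq> V" "T \<subseteq> V"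
  shows "forcing_closure E T \<subseteq> V"
proof -
  have "\<nexists>S'. force_step E V S'"
  proof
    assume "\<exists>S'. force_step E V S'"
    then obtain u v where "nbrs E u - V = {v}"
      by (auto simp: force_step_def)
    then show False
      using assms(2)[of "{u, v}"] by (auto simp: nbrs_def)
  qed
  then show ?thesis
    using force_steps_subset_stalled forcing_closure_props(1)[OF assms] assms(3) by metis
qed

text \<open>A vertex adjacent to one twin is adjacent to both, so it never has exactly one missing
  neighbour while both are missing. Hence \<open>V - {u, v}\<close> is stalled and contains the
  closure of every initial set that avoids both.\<close>

lemma twins_meet_forcing_set:
  assumes "finite V" "\<And>e. e \<in> E \<Longrightarrow> e \<subseteq> V" "T \<subseteq> V" "forcing_closure E T = V"
    and "u \<in> V" "u \<noteq> v" "\<And>x. {x, u} \<in> E \<longleftrightarrow> {x, v} \<in> E"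
  shows "u \<in> T \<or> v \<in> T"
proof (rule ccontr)
  assume "\<not> (u \<in> T \<or> v \<in> T)"
  then have "T \<subseteq> V - {u, v}"
    using assms(3) by auto
  moreover have "\<nexists>S'. force_step E (V - {u, v}) S'"
  proof
    assume "\<exists>S'. force_step E (V - {u, v}) S'"
    then obtain x y where xy: "nbrs E x - (V - {u, v}) = {y}"
      by (auto simp: force_step_def)
    then have "{x, y} \<in> E"
      by (auto simp: nbrs_def)
    then have "y \<in> {u, v}"
      using xy assms(2)[of "{x, y}"] by blast
    then have "{u, v} \<subseteq> nbrs E x - (V - {u, v})"
      using \<open>{x, y} \<in> E\<close> assms(7)[of x] by (auto simp: nbrs_def)
    then show False
      using xy assms(6) by auto
  qed
  ultimately have "forcing_closure E T \<subseteq> V - {u, v}"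
    using force_steps_subset_stalled forcing_closure_props(1)[OF assms(1-3)] by metis
  then show False
    using assms(4,5) by auto
qed

section \<open>Flipping a bit\<close>

text \<open>Positions are list indices here, so \<open>flip i\<close> changes the bit numbered \<open>i + 1\<close>.\<close>

definition flip :: "nat \<Rightarrow> bool list \<Rightarrow> bool list" where
  "flip i w = w[i := \<not> w ! i]"

lemma length_flip [simp]: "length (flip i w) = length w"
  by (simp add: flip_def)

lemma nth_flip: "i < length w \<Longrightarrow> flip i w ! k = (if k = i then \<not> w ! i else w ! k)"
  by (simp add: flip_def nth_list_update)

lemma flip_flip [simp]: "i < length w \<Longrightarrow> flip i (flip i w) = w"
  by (simp add: flip_def)

lemma flip_neq: "i < length w \<Longrightarrow> flip i w \<noteq> w"
  using nth_flip[of i w i] by auto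

lemma finite_words [simp]: "finite {w :: bool list. length w = r}"
  using finite_lists_length_eq[of "UNIV :: bool set" r] by simp

lemma card_words: "card {w :: bool list. length w = r} = 2 ^ r"
  using card_lists_length_eq[of "UNIV :: bool set" r] by simp

lemma card_flip_image:
  assumes "i < r" "A \<subseteq> {w. length w = r}"
  shows "card (flip i ` A) = card A"
proof (rule card_image, rule inj_onI)
  fix x y assume xy: "x \<in> A" "y \<in> A" "flip i x = flip i y"
  then have "length x = r" "length y = r"
    using assms(2) by auto
  then show "x = y"
    using assms(1) xy(3) flip_flip by metis
qed

text \<open>Flipping is an involution, so \<open>A\<close> and its equally large image under
  \<open>flip i\<close> cover all words.\<close>

lemma card_flip_transversal_ge:
  assumes "i < r" "A \<subseteq> {w. length w = r}" "\<And>w. length w = r \<Longrightarrow> w \<in> A \<or> flip i w \<in> A"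
  shows "2 ^ r \<le> 2 * card A"
proof -
  have fin: "finite A"
    using assms(2) finite_words finite_subset by blast
  have "{w. length w = r} \<subseteq> A \<union> flip i ` A"
  proof
    fix w :: "bool list" assume "w \<in> {w. length w = r}"
    then have "w \<in> A \<or> flip i w \<in> A" "w = flip i (flip i w)"
      using assms(1) assms(3)[of w] by simp_all
    then show "w \<in> A \<union> flip i ` A"
      by blast
  qed
  then have "2 ^ r \<le> card (A \<union> flip i ` A)"
    using fin card_mono[of "A \<union> flip i ` A" "{w. length w = r}"] by (simp add: card_words)
  also have "\<dots> \<le> 2 * card A"
    using card_Un_le[of A "flip i ` A"] card_flip_image[OF assms(1,2)] by simp
  finally show ?thesis .
qed

text \<open>Dual count: here \<open>A\<close> and its image under \<open>flip i\<close> are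
  disjoint.\<close>

lemma card_flip_avoiding_le:
  assumes "i < r" "A \<subseteq> {w. length w = r}" "\<And>w. w \<in> A \<Longrightarrow> flip i w \<notin> A"
  shows "2 * card A \<le> 2 ^ r"
proof -
  have fin: "finite A"
    using assms(2) finite_words finite_subset by blast
  have "2 * card A = card (A \<union> flip i ` A)"
    using fin assms(3) card_flip_image[OF assms(1,2)] by (subst card_Un_disjoint) auto
  also have "\<dots> \<le> 2 ^ r"
    unfolding card_words[symmetric] using assms(2) by (intro card_mono) auto
  finally show ?thesis .
qed

section \<open>Butterfly networks\<close>

lemma differ_iff_flip:
  assumes "length w = r" "length w' = r" "i < r"
  shows "{k \<in> {1..r}. w ! (k - 1) \<noteq> w' ! (k - 1)} = {Suc i} \<longleftrightarrow> w' = flip i w"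
proof
  assume L: "{k \<in> {1..r}. w ! (k - 1) \<noteq> w' ! (k - 1)} = {Suc i}"
  have *: "w ! k \<noteq> w' ! k \<longleftrightarrow> k = i" if "k < r" for k
  proof -
    have "Suc k \<in> {k \<in> {1..r}. w ! (k - 1) \<noteq> w' ! (k - 1)} \<longleftrightarrow> Suc k \<in> {Suc i}"
      unfolding L ..
    then show ?thesis
      using that by simp
  qed
  show "w' = flip i w"
  proof (rule nth_equalityI)
    show "w' ! k = flip i w ! k" if "k < length w'" for k
      using *[of k] that assms by (cases "k = i") (auto simp: nth_flip)
  qed (simp add: assms)
next
  assume "w' = flip i w"
  then have "w ! k \<noteq> w' ! k \<longleftrightarrow> k = i" for k
    using assms by (simp add: nth_flip)
  then have "{k \<in> {1..r}. w ! (k - 1) \<noteq> w' ! (k - 1)} = {k \<in> {1..r}. k - 1 = i}"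
    by presburger
  also have "\<dots> = {Suc i}"
    using assms(3) by auto
  finally show "{k \<in> {1..r}. w ! (k - 1) \<noteq> w' ! (k - 1)} = {Suc i}" .
qed

lemma bf_edges_iff:
  "e \<in> bf_edges r \<longleftrightarrow>
    (\<exists>w w' i. e = {(w, i), (w', Suc i)} \<and> length w = r \<and> i < r \<and> (w' = w \<or> w' = flip i w))"
proof
  assume "e \<in> bf_edges r"
  then obtain w i w' where e: "e = {(w, i), (w', Suc i)}" "length w = r" "length w' = r" "i < r"
    "w = w' \<or> {k \<in> {1..r}. w ! (k - 1) \<noteq> w' ! (k - 1)} = {Suc i}"
    unfolding bf_edges_def bf_verts_def by auto
  then have "w' = w \<or> w' = flip i w"
    using differ_iff_flip[of w r w' i] by auto
  then show "\<exists>w w' i. e = {(w, i), (w', Suc i)} \<and> length w = r \<and> i < r \<and> (w' = w \<or> w' = flip i w)"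
    using e by blast
next
  assume "\<exists>w w' i. e = {(w, i), (w', Suc i)} \<and> length w = r \<and> i < r \<and> (w' = w \<or> w' = flip i w)"
  then obtain w w' i where e: "e = {(w, i), (w', Suc i)}" "length w = r" "i < r"
    "w' = w \<or> w' = flip i w"
    by blast
  then have "length w' = r"
    by auto
  then have "w = w' \<or> {k \<in> {1..r}. w ! (k - 1) \<noteq> w' ! (k - 1)} = {Suc i}"
    using e differ_iff_flip[of w r w' i] by blast
  then show "e \<in> bf_edges r"
    unfolding bf_edges_def bf_verts_def using e(1-3) \<open>length w' = r\<close>
    by (intro CollectI exI[of _ w] exI[of _ i] exI[of _ w'] exI[of _ "Suc i"]) simp
qed

lemma bf_edge_iff:
  assumes "length w = r"
  shows "{(v, j), (w, i)} \<in> bf_edges r \<longleftrightarrow>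
    (j = Suc i \<and> i < r \<and> (v = w \<or> v = flip i w)) \<or>
    (i = Suc j \<and> j < r \<and> (v = w \<or> v = flip j w))"
    (is "?L \<longleftrightarrow> ?R")
proof
  assume ?L
  then obtain a b k where ab: "{(v, j), (w, i)} = {(a, k), (b, Suc k)}" "length a = r" "k < r"
    "b = a \<or> b = flip k a"
    unfolding bf_edges_iff by blast
  then consider "v = a" "j = k" "w = b" "i = Suc k" | "v = b" "j = Suc k" "w = a" "i = k"
    by (auto simp: doubleton_eq_iff)
  then show ?R
    using ab by cases auto
next
  assume ?R
  then show ?L
  proof
    assume "j = Suc i \<and> i < r \<and> (v = w \<or> v = flip i w)"
    then show ?L
      unfolding bf_edges_iff using assms
      by (intro exI[of _ w] exI[of _ v] exI[of _ i]) auto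
  next
    assume "i = Suc j \<and> j < r \<and> (v = w \<or> v = flip j w)"
    then show ?L
      unfolding bf_edges_iff using assms
      by (intro exI[of _ v] exI[of _ w] exI[of _ j]) auto
  qed
qed

text \<open>The level below is included wholesale: forcing will run upwards from filled levels, so
  only the two upper neighbours matter.\<close>

lemma bf_nbrs:
  assumes "length w = r"
  shows "nbrs (bf_edges r) (w, i) \<subseteq>
    {(w, Suc i), (flip i w, Suc i)} \<union> {(v, j). length v = r \<and> i = Suc j}"
proof
  fix x assume "x \<in> nbrs (bf_edges r) (w, i)"
  then obtain v j where "x = (v, j)" "{(v, j), (w, i)} \<in> bf_edges r"
    by (cases x) (auto simp: nbrs_def insert_commute)
  then show "x \<in> {(w, Suc i), (flip i w, Suc i)} \<union> {(v, j). length v = r \<and> i = Suc j}"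
    using assms by (auto simp: bf_edge_iff)
qed

section \<open>Lower bound\<close>

lemma card_bf_edge_forcing_set_ge:
  assumes "r \<ge> 2" "finite K" "edge_forcing_set (bf_verts r) (bf_edges r) K"
  shows "2 ^ r \<le> card K"
proof -
  let ?V = "bf_verts r" and ?E = "bf_edges r" and ?T = "\<Union>K"
  define A where "A l = {w. length w = r \<and> (w, l) \<in> ?T}" for l
  have K: "K \<subseteq> ?E" and cl: "forcing_closure ?E ?T = ?V"
    using assms(3) by (auto simp: edge_forcing_set_def)
  have T: "?T \<subseteq> ?V"
    using K bf_edges_subset by blast
  \<comment> \<open>Level \<open>r\<close> is reached only from level \<open>r - 1\<close>, along
    edges that flip list index \<open>r - 1\<close>; this makes \<open>flip (r - 1)\<close> the twin
    map there.\<close>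
  have outer: "2 ^ r \<le> 2 * card (A l)" if l: "l = 0 \<and> i = 0 \<or> l = r \<and> i = r - 1" for l i
  proof (rule card_flip_transversal_ge)
    show ir: "i < r"
      using l assms(1) by auto
    fix w :: "bool list" assume w: "length w = r"
    have "(w, l) \<in> ?T \<or> (flip i w, l) \<in> ?T"
    proof (rule twins_meet_forcing_set[OF finite_bf_verts bf_edges_subset T cl])
      show "(w, l) \<in> ?V"
        using w l by (auto simp: bf_verts_def)
      show "(w, l) \<noteq> (flip i w, l)"
        using flip_neq[of i w] w ir by auto
      show "{x, (w, l)} \<in> ?E \<longleftrightarrow> {x, (flip i w, l)} \<in> ?E" for x
        using l w ir by (cases x) (auto simp: bf_edge_iff)
    qed
    then show "w \<in> A l \<or> flip i w \<in> A l"
      using w by (auto simp: A_def)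
  qed (auto simp: A_def)
  define X where "X = (\<lambda>w. (w, 0)) ` A 0 \<union> (\<lambda>w. (w, r)) ` A r"
  have fin: "finite (A l)" for l
    using finite_subset[OF _ finite_words[of r]] by (auto simp: A_def)
  have "card X = card (A 0) + card (A r)"
    unfolding X_def using fin assms(1)
    by (subst card_Un_disjoint) (auto simp: card_image inj_on_def)
  then have "2 ^ r \<le> card X"
    using outer[of 0 0] outer[of r "r - 1"] by simp
  also have "X \<subseteq> (\<Union>e\<in>K. e \<inter> X)"
    by (auto simp: X_def A_def)
  then have "card X \<le> card (\<Union>e\<in>K. e \<inter> X)"
    using assms(2) fin by (intro card_mono) (auto simp: X_def)
  also have "\<dots> \<le> (\<Sum>e\<in>K. card (e \<inter> X))"
    by (rule card_UN_le[OF assms(2)])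
  also have "\<dots> \<le> (\<Sum>e\<in>K. 1)"
  proof (rule sum_mono)
    fix e assume "e \<in> K"
    then have "e \<in> ?E"
      using K by blast
    then obtain w w' i where "e = {(w, i), (w', Suc i)}"
      unfolding bf_edges_iff by blast
    \<comment> \<open>Consecutive levels cannot be \<open>0\<close> and \<open>r\<close>, as
      \<open>r \<ge> 2\<close>.\<close>
    then have "e \<inter> X \<subseteq> {(w, i)} \<or> e \<inter> X \<subseteq> {(w', Suc i)}"
      using assms(1) by (auto simp: X_def)
    then show "card (e \<inter> X) \<le> 1"
      using card_mono[of "{(w, i)}" "e \<inter> X"] card_mono[of "{(w', Suc i)}" "e \<inter> X"] by auto
  qed
  finally show ?thesis
    by simp
qed

section \<open>Upper bound\<close>

text \<open>Selects the straight edges leaving level \<open>i\<close>. List indices are one less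
  than bit numbers: \<open>w ! 1\<close> and \<open>w ! 3\<close> are bits 2 and 4, and
  \<open>w ! (i - 1)\<close>, \<open>w ! i\<close> are bits \<open>i\<close> and
  \<open>i + 1\<close>. Flipping either of the two compared bits toggles the condition.\<close>

definition picked :: "bool list \<Rightarrow> nat \<Rightarrow> bool" where
  "picked w i \<longleftrightarrow> i = 0 \<or> (i = 2 \<and> w ! 1 \<noteq> w ! 3) \<or> (i = 3 \<and> w ! 1 = w ! 3) \<or>
    (i \<ge> 5 \<and> odd i \<and> w ! (i - 1) = w ! i)"

definition straight_edge :: "bool list \<Rightarrow> nat \<Rightarrow> (bool list \<times> nat) set" where
  "straight_edge w i = {(w, i), (w, Suc i)}"

definition picked_edges :: "nat \<Rightarrow> (bool list \<times> nat) set set" where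
  "picked_edges r = {straight_edge w i |w i. length w = r \<and> i < r \<and> picked w i}"

lemma picked_edges_subset: "picked_edges r \<subseteq> bf_edges r"
  unfolding picked_edges_def straight_edge_def bf_edges_iff subset_iff by blast

text \<open>Distinct straight edges meet only for the same word and consecutive levels. Among the
  levels 0, 2, 3, 5, 7, ... only 2 and 3 are consecutive, and their conditions exclude each
  other.\<close>

lemma not_picked_Suc: "picked w i \<Longrightarrow> \<not> picked w (Suc i)"
  by (auto simp: picked_def)

lemma disjoint_picked_edges: "disjoint (picked_edges r)"
proof (rule disjointI)
  fix e f assume "e \<in> picked_edges r" "f \<in> picked_edges r" "e \<noteq> f"
  then obtain w i v j where "e = straight_edge w i" "f = straight_edge v j"
    "picked w i" "picked v j" "(w, i) \<noteq> (v, j)"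
    by (auto simp: picked_edges_def)
  then show "e \<inter> f = {}"
    using not_picked_Suc[of w i] not_picked_Suc[of v j] by (auto simp: straight_edge_def)
qed

lemma picked_edges_cover:
  assumes "length w = r" "i < r" "picked w i"
  shows "(w, i) \<in> \<Union>(picked_edges r)" "(w, Suc i) \<in> \<Union>(picked_edges r)"
  using assms by (auto simp: picked_edges_def straight_edge_def)

lemma picked_edges_transversal:
  assumes "even r" "r \<ge> 4" "length w = r" "i \<ge> 1" "i < r"
  shows "(w, Suc i) \<in> \<Union>(picked_edges r) \<or> (flip i w, Suc i) \<in> \<Union>(picked_edges r)"
proof -
  \<comment> \<open>Here \<open>j\<close> is the lower level of a picked edge with its lower or
    upper end in level \<open>Suc i\<close>.\<close>
  have "\<exists>j<r. (Suc i = j \<or> Suc i = Suc j) \<and> (picked w j \<or> picked (flip i w) j)"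
  proof -
    consider "i = 1" | "i = 2" | "i = 3" | "i \<ge> 4" "even i" | "i \<ge> 5" "odd i"
    proof -
      have "i = 1 \<or> i = 2 \<or> i = 3 \<or> i = 4 \<or> i \<ge> 5"
        using assms(4) by linarith
      then show thesis
        using that by (cases "even i") auto
    qed
    then show ?thesis
    proof cases
      case 1
      then show ?thesis
        using assms by (intro exI[of _ 2]) (auto simp: picked_def nth_flip)
    next
      case 2
      \<comment> \<open>Flipping index 2 affects neither compared bit, but all of level 3 is
        covered: each of its vertices ends an edge from level 2 or starts one to level 4.\<close>
      show ?thesis
      proof (cases "w ! 1 = w ! 3")
        case True
        then show ?thesis
          using 2 assms by (intro exI[of _ 3]) (auto simp: picked_def)
      next
        case False
        then show ?thesis
          using 2 assms by (intro exI[of _ 2]) (auto simp: picked_def)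
      qed
    next
      case 3
      then show ?thesis
        using assms by (intro exI[of _ 3]) (auto simp: picked_def nth_flip)
    next
      case 4
      \<comment> \<open>Parity excludes \<open>i = r - 1\<close>, so there is a level above
        \<open>Suc i\<close> for the picked edge to reach.\<close>
      then have "Suc i < r"
        using assms by (metis Suc_lessI even_Suc)
      then show ?thesis
        using 4 assms by (intro exI[of _ "Suc i"]) (auto simp: picked_def nth_flip)
    next
      case 5
      then show ?thesis
        using assms by (intro exI[of _ i]) (auto simp: picked_def nth_flip)
    qed
  qed
  then show ?thesis
    using picked_edges_cover[of w r] picked_edges_cover[of "flip i w" r] assms(3)
    by (metis length_flip)
qed

lemma edge_forcing_set_picked_edges:
  assumes "even r" "r \<ge> 4"
  shows "edge_forcing_set (bf_verts r) (bf_edges r) (picked_edges r)"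
proof -
  let ?V = "bf_verts r" and ?E = "bf_edges r" and ?T = "\<Union>(picked_edges r)"
  let ?C = "forcing_closure ?E ?T"
  have T: "?T \<subseteq> ?V"
    using picked_edges_subset bf_edges_subset by blast
  note closure = forcing_closure_props[OF finite_bf_verts bf_edges_subset T]
  have TC: "?T \<subseteq> ?C"
    using closure(1) force_steps_increasing by blast
  have "\<forall>w. length w = r \<longrightarrow> (w, i) \<in> ?C" if "i \<le> r" for i
    using that
  proof (induction i rule: less_induct)
    case (less i)
    show ?case
    proof (intro allI impI)
      fix w :: "bool list" assume w: "length w = r"
      show "(w, i) \<in> ?C"
      proof (cases "i \<le> 1")
        case True
        then have "(w, i) \<in> ?T"
          using picked_edges_cover[of w r 0] w assms(2) by (cases i) (auto simp: picked_def)
        then show ?thesis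
          using TC by blast
      next
        case False
        then obtain k where k: "i = Suc k" "k \<ge> 1" "k < r"
          using less.prems by (cases i) auto
        show ?thesis
        \<comment> \<open>If \<open>(w, i)\<close> were missing, its partner
          \<open>(flip k w, i)\<close> would be present by transversality. Level
          \<open>k - 1\<close> is filled, so \<open>(w, k)\<close> could force
          \<open>(w, i)\<close>, although the closure is stalled.\<close>
        proof (rule ccontr)
          assume not_in: "(w, i) \<notin> ?C"
          then have "(flip k w, Suc k) \<in> ?C"
            using picked_edges_transversal[OF assms w k(2,3)] TC k(1) by blast
          moreover have "(v, j) \<in> ?C" if "length v = r" "k = Suc j" for v j
            using that less.IH[of j] k by auto
          ultimately have "nbrs ?E (w, k) - ?C \<subseteq> {(w, i)}"
            using bf_nbrs[OF w, of k] k(1) by blast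
          moreover have "(w, i) \<in> nbrs ?E (w, k)"
            using k w by (simp add: nbrs_def bf_edge_iff)
          ultimately have "nbrs ?E (w, k) - ?C = {(w, i)}"
            using not_in by blast
          moreover have "(w, k) \<in> ?C"
            using less.IH[of k] k w by auto
          ultimately have "force_step ?E ?C (insert (w, i) ?C)"
            unfolding force_step_def by blast
          then show False
            using closure(2) by blast
        qed
      qed
    qed
  qed
  then have "?V \<subseteq> ?C"
    by (auto simp: bf_verts_def)
  then show ?thesis
    using forcing_closure_subset[OF finite_bf_verts bf_edges_subset T]
      picked_edges_subset disjoint_picked_edges
    by (auto simp: edge_forcing_set_def)
qed

text \<open>Level 0 gives one edge per word, and levels 2 and 3 together give one more. Each of the
  \<open>r div 2 - 2\<close> odd levels from 5 to \<open>r - 1\<close> gives an edge for at most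
  half of the words.\<close>

lemma card_picked_edges_le:
  assumes "even r" "r \<ge> 4"
  shows "2 * card (picked_edges r) \<le> (r div 2 + 2) * 2 ^ r"
proof -
  let ?W = "{w :: bool list. length w = r}"
  define A where "A = (\<lambda>w. straight_edge w 0) ` ?W"
  define B where "B = (\<lambda>w. straight_edge w (if w ! 1 = w ! 3 then 3 else 2)) ` ?W"
  define D where "D m = (\<lambda>w. straight_edge w (2 * m + 1)) ` {w \<in> ?W. w ! (2 * m) = w ! (2 * m + 1)}"
    for m
  define M where "M = {2..<r div 2}"
  have sub: "picked_edges r \<subseteq> A \<union> B \<union> (\<Union>m\<in>M. D m)"
  proof
    fix e assume "e \<in> picked_edges r"
    then obtain w i where e: "e = straight_edge w i" "length w = r" "i < r" "picked w i"
      by (auto simp: picked_edges_def)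
    from e(4) consider "i = 0" | "i = 2" "w ! 1 \<noteq> w ! 3" | "i = 3" "w ! 1 = w ! 3"
      | "i \<ge> 5" "odd i" "w ! (i - 1) = w ! i"
      by (auto simp: picked_def)
    then show "e \<in> A \<union> B \<union> (\<Union>m\<in>M. D m)"
    proof cases
      case 4
      then obtain m where m: "i = 2 * m + 1"
        by (elim oddE)
      then have "e \<in> D m"
        using 4 e by (auto simp: D_def)
      moreover have "m \<in> M"
      proof -
        obtain n where "r = 2 * n"
          using assms(1) by (elim evenE)
        then show ?thesis
          using 4(1) e(3) m by (simp add: M_def)
      qed
      ultimately show ?thesis
        by blast
    qed (use e in \<open>auto simp: A_def B_def\<close>)
  qed
  have D: "2 * card (D m) \<le> 2 ^ r" if "m \<in> M" for m
  proof -
    have m: "2 * m + 1 < r"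
      using that by (auto simp: M_def)
    have "card (D m) \<le> card {w \<in> ?W. w ! (2 * m) = w ! (2 * m + 1)}"
      unfolding D_def by (rule card_image_le) simp
    moreover have "2 * card {w \<in> ?W. w ! (2 * m) = w ! (2 * m + 1)} \<le> 2 ^ r"
      \<comment> \<open>Flipping index \<open>2 * m\<close> destroys the equality of the two
        bits.\<close>
      using m by (intro card_flip_avoiding_le[of "2 * m"]) (auto simp: nth_flip)
    ultimately show ?thesis
      by linarith
  qed
  have AB: "card A \<le> 2 ^ r" "card B \<le> 2 ^ r"
    unfolding A_def B_def card_words[symmetric] by (rule card_image_le, simp)+
  have "finite M" "finite A" "finite B" "finite (D m)" for m
    by (auto simp: M_def A_def B_def D_def)
  then have "card (picked_edges r) \<le> card (A \<union> B \<union> (\<Union>m\<in>M. D m))"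
    using sub by (intro card_mono) auto
  also have "\<dots> \<le> card A + card B + card (\<Union>m\<in>M. D m)"
    using card_Un_le[of "A \<union> B" "\<Union>m\<in>M. D m"] card_Un_le[of A B] by linarith
  also have "\<dots> \<le> 2 ^ r + 2 ^ r + (\<Sum>m\<in>M. card (D m))"
    using AB card_UN_le[OF \<open>finite M\<close>, of D] by linarith
  finally have "2 * card (picked_edges r) \<le> 4 * 2 ^ r + (\<Sum>m\<in>M. 2 * card (D m))"
    by (simp add: sum_distrib_left[symmetric])
  also have "\<dots> \<le> 4 * 2 ^ r + (\<Sum>m\<in>M. 2 ^ r)"
    using D by (intro add_left_mono sum_mono)
  also have "\<dots> = (4 + (r div 2 - 2)) * 2 ^ r"
    by (simp add: M_def algebra_simps)
  \<comment> \<open>The truncated subtraction is exact because \<open>r \<ge> 4\<close>.\<close>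
  also have "4 + (r div 2 - 2) = r div 2 + 2"
    using assms(2) by linarith
  finally show ?thesis .
qed

theorem theorem4p11:
  fixes r :: nat
  assumes "even r" and "r \<ge> 4"
  shows "2 ^ r \<le> edge_forcing_number (bf_verts r) (bf_edges r) \<and>
    real (edge_forcing_number (bf_verts r) (bf_edges r)) \<le> (real r / 2 + 2) * 2 ^ (r - 1)"
proof
  define N where "N = {card K |K. finite K \<and> edge_forcing_set (bf_verts r) (bf_edges r) K}"
  have num: "edge_forcing_number (bf_verts r) (bf_edges r) = Inf N"
    by (simp add: edge_forcing_number_def N_def)
  have "finite (bf_edges r)"
    using finite_subset[of "bf_edges r" "Pow (bf_verts r)"] finite_bf_verts bf_edges_subset by auto
  then have "finite (picked_edges r)"
    using picked_edges_subset finite_subset by blast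
  then have mem: "card (picked_edges r) \<in> N"
    using edge_forcing_set_picked_edges[OF assms] by (auto simp: N_def)
  \<comment> \<open>As \<open>N\<close> is nonempty, \<open>Inf N\<close> is an attained minimum and
    not the default value \<open>0\<close>.\<close>
  then have "Inf N \<in> N"
    using Inf_nat_def1 by blast
  then show "2 ^ r \<le> edge_forcing_number (bf_verts r) (bf_edges r)"
    unfolding num using card_bf_edge_forcing_set_ge[of r] assms(2) by (auto simp: N_def)
  have "Inf N \<le> card (picked_edges r)"
    using mem by (rule wellorder_Inf_le1)
  then have "2 * Inf N \<le> (r div 2 + 2) * 2 ^ r"
    using card_picked_edges_le[OF assms] by linarith
  then have "real (2 * Inf N) \<le> real ((r div 2 + 2) * 2 ^ r)"
    by (rule of_nat_mono)
  \<comment> \<open>Evenness makes \<open>r div 2\<close> agree with the real quotient.\<close>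
  also have "\<dots> = (real r / 2 + 2) * 2 ^ r"
    using assms(1) by (simp add: real_of_nat_div algebra_simps)
  also have "(2::real) ^ r = 2 * 2 ^ (r - 1)"
    using assms(2) by (cases r) auto
  finally show "real (edge_forcing_number (bf_verts r) (bf_edges r)) \<le> (real r / 2 + 2) * 2 ^ (r - 1)"
    unfolding num by simp
qed

end
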